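(* Let $B\subseteq\mathbb{N}^+$ be an infinite set and suppose that $$\limsup_{n\to\infty}\frac{|B\cap[1,n]|\,\log\log n}{\log n}<1.$$ Then for each $\alpha\in[0,1]$ there exists a set $A\subseteq\mathbb{N}^+$ such that $\mathsf{d}(A)=\mathsf{d}(A+B)=\alpha$.
   Context: $\mathbb{N}^+=\{1,2,\ldots\}$. For $S\subseteq \mathbb{N}^+$, the asymptotic density is $\mathsf{d}(S):=\lim_{n\to\infty} |S\cap[1,n]|/n$, provided the limit exists; "$\mathsf{d}(S)=\alpha$" means that the limit exists and equals $\alpha$. The sumset is $A+B:=\{x+y: x\in A, y\in B\}$. *)

theory Defs
  imports "HOL-Analysis.Analysis" "HOL-Library.Set_Algebras"
begin

text \<open>Relational form of asymptotic density: the limit exists and equals \<open>\<alpha>\<close>.\<close>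

definition has_density :: "nat set \<Rightarrow> real \<Rightarrow> bool" where
  "has_density S \<alpha> \<longleftrightarrow>
     (\<lambda>n. real (card (S \<inter> {1..n})) / real n) \<longlonglongrightarrow> \<alpha>"

end

theory Submission
  imports Defs "HOL-Real_Asymp.Real_Asymp"
begin

text \<open>
  The hypothesis makes \<open>B\<close> so sparse that, on a logarithmic scale, it regularly has gaps
  \<open>(w, w L\<^sup>p]\<close> with \<open>p > 1\<close> near \<open>exp L\<close>. Cut \<open>\<nat>\<close> into blocks \<open>(t\<^sub>i, t\<^sub>i\<^sub>+\<^sub>1]\<close> with every \<open>t\<^sub>i\<close> inside such a
  gap, and let \<open>A\<close> agree on the \<open>i\<close>-th block with the Bohr set of all \<open>n\<close> with \<open>frac (n \<theta>\<^sub>i) < \<alpha>\<close>.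
  Only \<open>o(log t\<^sub>i)\<close> elements of \<open>B\<close> lie below \<open>t\<^sub>i\<^sub>+\<^sub>1\<close>, so Dirichlet's simultaneous approximation
  theorem yields \<open>\<theta>\<^sub>i\<close> such that \<open>b \<theta>\<^sub>i\<close> is nearly an integer for all of them at once, with \<open>\<theta>\<^sub>i\<close> tending
  to \<open>0\<close> but \<open>\<theta>\<^sub>i t\<^sub>i\<close> to infinity. Sums \<open>a + b\<close> within one block then stay in a slightly enlarged Bohr
  set. Sums leaving the block of \<open>a\<close> are negligible: just after \<open>t\<^sub>i\<close> there are at most \<open>w\<close> of them, and
  all others use some \<open>b > w L\<^sup>p\<close>, so there are at most \<open>t\<^sub>i |B \<inter> [1,N]| = o(N)\<close> of them up to \<open>N\<close>.
\<close>

section \<open>Density from estimates on blocks\<close>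

text \<open>Errors do not accumulate over the blocks: for \<open>n\<close> in block
  \<open>i + 1\<close>, only that block and block \<open>i\<close> are compared with \<alpha>, and
  everything up to \<open>t i\<close> is bounded trivially by \<open>t i\<close>, which
  \<open>growth\<close> makes negligible against \<open>t (Suc i)\<close>.\<close>

lemma has_density_piecewise:
  fixes S :: "nat set" and t :: "nat \<Rightarrow> nat" and \<delta> :: "nat \<Rightarrow> real"
  assumes \<alpha>: "0 \<le> \<alpha>" "\<alpha> \<le> 1"
    and t: "strict_mono t"
    and \<delta>: "\<delta> \<longlonglongrightarrow> 0"
    and growth: "\<And>i. real (t i) \<le> \<delta> i * real (t (Suc i))"
    and block: "\<And>i N. t i < N \<Longrightarrow> N \<le> t (Suc i) \<Longrightarrow>
      \<bar>real (card (S \<inter> {t i<..N})) - \<alpha> * (real N - real (t i))\<bar> \<le> \<delta> i * real N"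
  shows "has_density S \<alpha>"
proof -
  define g where "g n = real (card (S \<inter> {1..n})) - \<alpha> * real n" for n
  have g_le: "\<bar>g n\<bar> \<le> real n" for n
  proof -
    have "card (S \<inter> {1..n}) \<le> card {1..n}" by (intro card_mono) auto
    moreover have "0 \<le> \<alpha> * real n" "\<alpha> * real n \<le> real n"
      using \<alpha> by (simp_all add: mult_left_le_one_le)
    ultimately show ?thesis unfolding g_def by (auto simp: abs_if)
  qed
  have g_diff: "\<bar>g N - g (t i)\<bar> \<le> \<delta> i * real N" if "t i < N" "N \<le> t (Suc i)" for i N
  proof -
    have "S \<inter> {1..N} = (S \<inter> {1..t i}) \<union> (S \<inter> {t i<..N})" using that by auto
    then have "card (S \<inter> {1..N}) = card (S \<inter> {1..t i}) + card (S \<inter> {t i<..N})"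
      by (simp add: card_Un_disjoint[symmetric] Int_Un_distrib disjoint_iff)
    then show ?thesis using block[OF that] unfolding g_def by (simp add: algebra_simps)
  qed
  have "(\<lambda>n. g n / real n) \<longlonglongrightarrow> 0"
  proof (rule LIMSEQ_I)
    fix e :: real assume e: "e > 0"
    obtain i0 where i0: "\<And>i. i \<ge> i0 \<Longrightarrow> \<bar>\<delta> i\<bar> < e / 3"
      using LIMSEQ_D[OF \<delta>, of "e / 3"] e by auto
    show "\<exists>n0. \<forall>n\<ge>n0. norm (g n / real n - 0) < e"
    proof (intro exI allI impI)
      fix n assume n: "Suc (t (Suc i0)) \<le> n"
      \<comment> \<open>Since \<open>n > t (Suc i0)\<close>, the index \<open>j\<close> is at least
        \<open>i0 + 2\<close>. So the block containing \<open>n\<close> and its predecessor both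
        have index at least \<open>i0\<close>, where \<delta> is below \<open>e / 3\<close>.\<close>
      define j where "j = (LEAST k. n \<le> t k)"
      have ex: "n \<le> t n" using t by (simp add: strict_mono_imp_increasing)
      have nj: "n \<le> t j" unfolding j_def by (rule LeastI) (rule ex)
      have "Suc i0 < j"
      proof (rule ccontr)
        assume "\<not> Suc i0 < j"
        then have "t j \<le> t (Suc i0)" using t by (simp add: strict_mono_less_eq)
        with n nj show False by simp
      qed
      then obtain i where j: "j = Suc (Suc i)" and i: "i0 \<le> i"
        by (metis Suc_leD Suc_le_D Suc_le_mono less_eq_Suc_le)
      have tj: "t (Suc i) < n"
        using not_less_Least[of "Suc i" "\<lambda>k. n \<le> t k"] j unfolding j_def by auto
      have pos: "0 < real n" using n by simp
      have lt: "t i < t (Suc i)" using t by (simp add: strict_mono_less)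
      have "\<bar>g n\<bar> \<le> \<bar>g n - g (t (Suc i))\<bar> + \<bar>g (t (Suc i)) - g (t i)\<bar> + \<bar>g (t i)\<bar>" by linarith
      also have "\<dots> \<le> \<delta> (Suc i) * real n + \<delta> i * real (t (Suc i)) + \<delta> i * real (t (Suc i))"
        using g_diff[of "Suc i" n] g_diff[OF lt] g_le[of "t i"] growth[of i] tj nj j by auto
      also have "\<dots> < e/3 * real n + e/3 * real n + e/3 * real n"
      proof -
        have "\<delta> (Suc i) * real n < e/3 * real n" using i0[of "Suc i"] i pos by simp
        moreover have "\<delta> i * real (t (Suc i)) \<le> e/3 * real n"
          using i0[of i] i tj e by (intro mult_mono) auto
        ultimately show ?thesis by linarith
      qed
      finally have "\<bar>g n\<bar> < e * real n" by simp
      then show "norm (g n / real n - 0) < e" using pos by (simp add: field_simps)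
    qed
  qed
  then have "(\<lambda>n. g n / real n + \<alpha>) \<longlonglongrightarrow> 0 + \<alpha>" by (intro tendsto_intros)
  moreover have "\<forall>\<^sub>F n in sequentially. g n / real n + \<alpha> = real (card (S \<inter> {1..n})) / real n"
    using eventually_gt_at_top[of 0] by eventually_elim (simp add: g_def field_simps)
  ultimately show ?thesis unfolding has_density_def by (simp add: tendsto_cong)
qed

section \<open>Counting in Bohr sets\<close>

text \<open>The phase \<beta> allows an arc enlarged at both ends to be written again as a one-sided
  condition on a fractional part.\<close>

definition bohr :: "real \<Rightarrow> real \<Rightarrow> real \<Rightarrow> nat set" where
  "bohr \<theta> \<beta> \<gamma> = {n. frac (real n * \<theta> + \<beta>) < \<gamma>}"

text \<open>The function \<open>\<gamma> * \<lfloor>x\<rfloor> + min (frac x) \<gamma>\<close> is a primitive of the indicator of \<open>frac x < \<gamma>\<close>;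
  a Riemann sum of step \<open>\<theta>\<close> is off by at most \<open>\<theta>\<close> at each jump of the indicator, and the
  jumps are counted by the two floor functions.\<close>

lemma indicator_primitive_step:
  fixes x \<theta> \<gamma> :: real
  defines "h \<equiv> \<lambda>x. \<gamma> * of_int \<lfloor>x\<rfloor> + min (frac x) \<gamma>"
  assumes \<gamma>: "0 \<le> \<gamma>" "\<gamma> \<le> 1" and \<theta>: "0 < \<theta>" "\<theta> < 1"
  shows "\<bar>h (x + \<theta>) - h x - (if frac (x + \<theta>) < \<gamma> then \<theta> else 0)\<bar>
    \<le> \<theta> * ((of_int \<lfloor>x + \<theta>\<rfloor> + of_int \<lfloor>x + \<theta> - \<gamma>\<rfloor>) - (of_int \<lfloor>x\<rfloor> + of_int \<lfloor>x - \<gamma>\<rfloor>))"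
proof -
  define m where "m = \<lfloor>x\<rfloor>"
  define f where "f = frac x"
  have f: "0 \<le> f" "f < 1" and x: "x = of_int m + f"
    by (auto simp: f_def m_def frac_def frac_ge_0 frac_lt_1) linarith
  have fl_\<gamma>: "\<lfloor>of_int k + u - \<gamma>\<rfloor> = (if u < \<gamma> then k - 1 else k)" if "0 \<le> u" "u < 1" for u and k :: int
    using that \<gamma> by (auto simp: floor_eq_iff)
  have xg: "\<lfloor>x - \<gamma>\<rfloor> = (if f < \<gamma> then m - 1 else m)" unfolding x using f by (rule fl_\<gamma>)
  show ?thesis
  proof (cases "f + \<theta> < 1")
    case True
    have 1: "\<lfloor>x + \<theta>\<rfloor> = m" using True f \<theta> x by (auto simp: floor_eq_iff)
    have 2: "frac (x + \<theta>) = f + \<theta>" using 1 x by (simp add: frac_def)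
    have 3: "\<lfloor>x + \<theta> - \<gamma>\<rfloor> = (if f + \<theta> < \<gamma> then m - 1 else m)"
      using fl_\<gamma>[of "f + \<theta>" m] True f \<theta> x by (simp add: add.assoc)
    show ?thesis unfolding h_def 1 2 3 xg m_def[symmetric] f_def[symmetric] using f \<theta> by auto
  next
    case False
    have 1: "\<lfloor>x + \<theta>\<rfloor> = m + 1" using False f \<theta> x by (auto simp: floor_eq_iff)
    have 2: "frac (x + \<theta>) = f + \<theta> - 1" using 1 x by (simp add: frac_def)
    have 3: "\<lfloor>x + \<theta> - \<gamma>\<rfloor> = (if f + \<theta> - 1 < \<gamma> then m else m + 1)"
      using fl_\<gamma>[of "f + \<theta> - 1" "m + 1"] False f \<theta> x by (simp add: algebra_simps)
    show ?thesis unfolding h_def 1 2 3 xg m_def[symmetric] f_def[symmetric] using f \<theta> \<gamma> False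
      by (auto simp: algebra_simps)
  qed
qed

text \<open>The one-step estimate telescopes along the points \<open>\<beta> + n * \<theta>\<close>.
  The total error is \<theta> times the increase of the two floor functions, which is at most
  \<open>2 * N * \<theta> + 2\<close>. The primitive \<open>h\<close> differs from
  \<open>\<gamma> * x\<close> by a value in [0, 1], which costs \<open>1 / \<theta>\<close> after
  division by \<theta>.\<close>

lemma card_bohr:
  assumes \<gamma>: "0 \<le> \<gamma>" "\<gamma> \<le> 1" and \<theta>: "0 < \<theta>" "\<theta> < 1"
  shows "\<bar>real (card (bohr \<theta> \<beta> \<gamma> \<inter> {1..N})) - \<gamma> * real N\<bar> \<le> 1 / \<theta> + 2 * real N * \<theta> + 2"
proof -
  define h where "h x = \<gamma> * of_int \<lfloor>x\<rfloor> + min (frac x) \<gamma>" for x :: real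
  define F where "F N = card (bohr \<theta> \<beta> \<gamma> \<inter> {1..N})" for N
  define p where "p N = real N * \<theta> + \<beta>" for N
  have F_Suc: "\<theta> * real (F (Suc N)) - \<theta> * real (F N) = (if frac (p (Suc N)) < \<gamma> then \<theta> else 0)" for N
  proof -
    have "{1..Suc N} = insert (Suc N) {1..N}" by auto
    then show ?thesis by (auto simp: F_def p_def bohr_def algebra_simps)
  qed
  define W where "W x = real_of_int \<lfloor>x\<rfloor> + of_int \<lfloor>x - \<gamma>\<rfloor>" for x
  have "\<bar>h (p N) - h \<beta> - \<theta> * real (F N)\<bar> \<le> \<theta> * W (p N) - \<theta> * W \<beta>"
  proof (induction N)
    case 0
    show ?case by (simp add: F_def p_def)
  next
    case (Suc N)
    have p: "p (Suc N) = p N + \<theta>" by (simp add: p_def algebra_simps)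
    have "\<bar>h (p (Suc N)) - h (p N) - (\<theta> * real (F (Suc N)) - \<theta> * real (F N))\<bar>
        \<le> \<theta> * (W (p (Suc N)) - W (p N))"
      using indicator_primitive_step[OF \<gamma> \<theta>, of "p N"] unfolding F_Suc h_def p W_def .
    then show ?case using Suc by (simp only: right_diff_distrib)
  qed
  also have "\<dots> = \<theta> * (W (p N) - W \<beta>)" by (simp only: right_diff_distrib)
  also have "\<dots> \<le> \<theta> * (2 * real N * \<theta> + 2)"
  proof (intro mult_left_mono)
    show "W (p N) - W \<beta> \<le> 2 * real N * \<theta> + 2" unfolding p_def W_def by linarith
  qed (use \<theta> in auto)
  finally have 1: "\<bar>h (p N) - h \<beta> - \<theta> * real (F N)\<bar> \<le> \<theta> * (2 * real N * \<theta> + 2)" .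
  have h: "0 \<le> h x - \<gamma> * x \<and> h x - \<gamma> * x \<le> 1" for x
  proof -
    have "h x - \<gamma> * x = min (frac x) \<gamma> - \<gamma> * frac x" by (simp add: h_def frac_def algebra_simps)
    moreover have "\<gamma> * frac x \<le> \<gamma>" "\<gamma> * frac x \<le> frac x" "0 \<le> \<gamma> * frac x"
      using \<gamma> frac_lt_1[of x] by (auto intro: mult_left_le mult_left_le_one_le)
    ultimately show ?thesis using \<gamma> by linarith
  qed
  have "\<gamma> * p N - \<gamma> * \<beta> = \<theta> * (\<gamma> * real N)" by (simp add: p_def algebra_simps)
  then have "\<bar>h (p N) - h \<beta> - \<theta> * (\<gamma> * real N)\<bar> \<le> 1" using h[of "p N"] h[of \<beta>] by linarith
  with 1 have "\<bar>\<theta> * real (F N) - \<theta> * (\<gamma> * real N)\<bar> \<le> 1 + \<theta> * (2 * real N * \<theta> + 2)" by linarith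
  then have "\<theta> * \<bar>real (F N) - \<gamma> * real N\<bar> \<le> 1 + \<theta> * (2 * real N * \<theta> + 2)"
    using \<theta> by (metis abs_mult abs_of_pos right_diff_distrib)
  then have "\<bar>real (F N) - \<gamma> * real N\<bar> \<le> (1 + \<theta> * (2 * real N * \<theta> + 2)) / \<theta>"
    using \<theta> by (simp add: pos_le_divide_eq mult.commute)
  also have "\<dots> = 1 / \<theta> + 2 * real N * \<theta> + 2" using \<theta> by (simp add: field_simps)
  finally show ?thesis by (simp add: F_def)
qed

lemma card_bohr_block:
  assumes \<gamma>: "0 \<le> \<gamma>" "\<gamma> \<le> 1" and \<theta>: "0 < \<theta>" "\<theta> < 1" and "t < N"
  shows "\<bar>real (card (bohr \<theta> \<beta> \<gamma> \<inter> {t<..N})) - \<gamma> * (real N - real t)\<bar>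
    \<le> 2 / \<theta> + 4 * real N * \<theta> + 4"
proof -
  have "bohr \<theta> \<beta> \<gamma> \<inter> {1..N} = (bohr \<theta> \<beta> \<gamma> \<inter> {1..t}) \<union> (bohr \<theta> \<beta> \<gamma> \<inter> {t<..N})"
    using \<open>t < N\<close> by auto
  then have "card (bohr \<theta> \<beta> \<gamma> \<inter> {1..N})
      = card (bohr \<theta> \<beta> \<gamma> \<inter> {1..t}) + card (bohr \<theta> \<beta> \<gamma> \<inter> {t<..N})"
    by (simp add: card_Un_disjoint[symmetric] Int_Un_distrib disjoint_iff)
  moreover have "real t * \<theta> \<le> real N * \<theta>" using assms by simp
  ultimately show ?thesis
    using card_bohr[OF \<gamma> \<theta>, of \<beta> N] card_bohr[OF \<gamma> \<theta>, of \<beta> t] by (simp add: algebra_simps)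
qed

text \<open>Adding \<open>b\<close> rotates by an error \<open>e\<close> of size at most \<delta>.
  The extra phase \<delta> makes \<open>f + e + \<delta>\<close> nonnegative, so its fractional part
  cannot exceed it, even if it passes 1. The cap at 1 keeps the arc length in the range required for
  counting.\<close>

lemma bohr_shift:
  assumes "a \<in> bohr \<theta> 0 \<alpha>" and "\<bar>real b * \<theta> - of_int p\<bar> \<le> \<delta>"
  shows "a + b \<in> bohr \<theta> \<delta> (min 1 (\<alpha> + 2 * \<delta>))"
proof -
  define e where "e = real b * \<theta> - of_int p"
  define f where "f = frac (real a * \<theta>)"
  have e: "\<bar>e\<bar> \<le> \<delta>" and f: "0 \<le> f" "f < \<alpha>" using assms by (auto simp: e_def f_def bohr_def frac_ge_0)
  have eq: "real (a + b) * \<theta> + \<delta> = (f + e + \<delta>) + of_int (\<lfloor>real a * \<theta>\<rfloor> + p)"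
    by (simp add: e_def f_def frac_def algebra_simps)
  have "frac (real (a + b) * \<theta> + \<delta>) \<le> f + e + \<delta>"
    unfolding eq using e f by (simp add: frac_def)
  then show ?thesis using e f frac_lt_1[of "real (a + b) * \<theta> + \<delta>"] by (auto simp: bohr_def)
qed

section \<open>Density of the sumset, given suitable scales\<close>

text \<open>The numbers \<open>z i\<close> and \<open>y i\<close> are the ends of a gap of
  \<open>B\<close> around the cut \<open>t i\<close>, \<open>\<theta> i\<close> is the rotation used
  on the block after \<open>t i\<close>, and \<open>\<delta> i\<close> bounds all relative errors at
  once. The assumption \<open>sparse\<close> controls sums that reach the block by a
  \<open>b\<close> beyond the gap.\<close>

lemma sumset_density_of_scales:
  fixes B :: "nat set" and t :: "nat \<Rightarrow> nat" and z y \<theta> \<delta> :: "nat \<Rightarrow> real"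
  assumes \<alpha>: "0 \<le> \<alpha>" "\<alpha> \<le> 1"
    and B: "B \<subseteq> {1..}" "B \<noteq> {}"
    and t: "strict_mono t"
    and \<delta>: "\<delta> \<longlonglongrightarrow> 0"
    and growth: "\<And>i. real (t i) \<le> \<delta> i * real (t (Suc i))"
    and gap: "\<And>i b. b \<in> B \<Longrightarrow> real b \<le> z i \<or> y i < real b"
    and z: "\<And>i. z i \<le> \<delta> i * real (t i)"
    and sparse: "\<And>i N. y i \<le> real N \<Longrightarrow> real (t i) * real (card (B \<inter> {1..N})) \<le> \<delta> i * real N"
    and \<theta>: "\<And>i. 0 < \<theta> i" "\<And>i. \<theta> i < 1" "\<And>i. \<theta> i \<le> \<delta> i" "\<And>i. 1 / \<theta> i \<le> \<delta> i * real (t i)"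
    and near: "\<And>i b. b \<in> B \<Longrightarrow> b \<le> t (Suc i) \<Longrightarrow> \<exists>p::int. \<bar>real b * \<theta> i - of_int p\<bar> \<le> \<delta> i"
  shows "\<exists>A. A \<subseteq> {1..} \<and> has_density A \<alpha> \<and> has_density (A + B) \<alpha>"
proof -
  define A where "A = {n. \<exists>i. t i < n \<and> n \<le> t (Suc i) \<and> n \<in> bohr (\<theta> i) 0 \<alpha>}"
  define \<gamma> where "\<gamma> i = min 1 (\<alpha> + 2 * \<delta> i)" for i
  define A' where "A' = {n. \<exists>i. t i < n \<and> n \<le> t (Suc i) \<and> n \<in> bohr (\<theta> i) (\<delta> i) (\<gamma> i)}"
  \<comment> \<open>\<open>U\<close> is an upper envelope of \<open>A + B\<close>. Including
    \<open>A'\<close> makes its density computable: on each block it is a Bohr set plus few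
    elements. The lower bound for \<open>A + B\<close> comes separately, from a translate of
    \<open>A\<close>.\<close>
  define U where "U = A' \<union> (A + B)"
  have \<delta>0: "0 < \<delta> i" for i using \<theta>(1,3)[of i] by linarith
  have index_unique: "i = j" if "t i < n" "n \<le> t (Suc i)" "t j < n" "n \<le> t (Suc j)" for i j n
  proof (rule ccontr)
    assume "i \<noteq> j"
    then consider "Suc i \<le> j" | "Suc j \<le> i" by linarith
    then show False
      using that strict_mono_less_eq[OF t] by cases (metis leD le_less_trans order_trans)+
  qed
  have A_iff: "n \<in> A \<longleftrightarrow> n \<in> bohr (\<theta> i) 0 \<alpha>"
    and A'_iff: "n \<in> A' \<longleftrightarrow> n \<in> bohr (\<theta> i) (\<delta> i) (\<gamma> i)"
    if "t i < n" "n \<le> t (Suc i)" for n i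
    unfolding A_def A'_def using index_unique[OF that] that by blast+
  \<comment> \<open>The 10 is 2 from \<open>2 / \<theta> i\<close>, 4 from
    \<open>4 * N * \<theta> i\<close>, and 4 from the constant, which is at most
    \<open>4 / \<theta> i\<close>.\<close>
  have small: "2 / \<theta> i + 4 * real N * \<theta> i + 4 \<le> 10 * (\<delta> i * real N)" if "t i < N" for i N
  proof -
    have "1 \<le> 1 / \<theta> i" using \<theta>(1,2)[of i] by simp
    moreover have "\<delta> i * real (t i) \<le> \<delta> i * real N" using that \<delta>0[of i] by simp
    moreover have "real N * \<theta> i \<le> \<delta> i * real N"
      using mult_left_mono[OF \<theta>(3)[of i], of "real N"] by (simp add: mult.commute)
    ultimately show ?thesis using \<theta>(4)[of i] by simp
  qed
  \<comment> \<open>The 14 is 10 from counting, 1 each for the exceptional sets \<open>E\<close> and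
    \<open>G\<close> below, and 2 for enlarging the arc from \<alpha> to
    \<open>\<gamma> i\<close>.\<close>
  have \<delta>': "(\<lambda>i. 14 * \<delta> i) \<longlonglongrightarrow> 0" using tendsto_mult_right_zero[OF \<delta>] by simp
  have growth': "real (t i) \<le> 14 * \<delta> i * real (t (Suc i))" for i
  proof -
    have "0 \<le> \<delta> i * real (t (Suc i))" using \<delta>0[of i] by simp
    then show ?thesis using growth[of i] by linarith
  qed
  have A_density: "has_density A \<alpha>"
  proof (rule has_density_piecewise[OF \<alpha> t \<delta>' growth'])
    fix i N assume N: "t i < N" "N \<le> t (Suc i)"
    have "A \<inter> {t i<..N} = bohr (\<theta> i) 0 \<alpha> \<inter> {t i<..N}"
    proof (rule set_eqI)
      fix n
      show "n \<in> A \<inter> {t i<..N} \<longleftrightarrow> n \<in> bohr (\<theta> i) 0 \<alpha> \<inter> {t i<..N}"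
        using A_iff[of i n] N by auto
    qed
    moreover have "0 \<le> \<delta> i * real N" using \<delta>0[of i] by simp
    ultimately show "\<bar>real (card (A \<inter> {t i<..N})) - \<alpha> * (real N - real (t i))\<bar> \<le> 14 * \<delta> i * real N"
      using card_bohr_block[OF \<alpha> \<theta>(1,2) N(1), of i 0] small[OF N(1)] by simp
  qed
  have U_density: "has_density U \<alpha>"
  proof (rule has_density_piecewise[OF \<alpha> t \<delta>' growth'])
    fix i N assume N: "t i < N" "N \<le> t (Suc i)"
    \<comment> \<open>For a sum \<open>a + b\<close> in block \<open>i\<close>: \<open>K\<close>
      covers \<open>a\<close> in the same block. For earlier \<open>a\<close>, \<open>E\<close>
      covers \<open>b\<close> below the gap, where the sum overshoots \<open>t i\<close> by at most
      \<open>z i\<close>, and \<open>G\<close> covers \<open>b\<close> beyond the gap, counted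
      crudely by pairs.\<close>
    define K where "K = bohr (\<theta> i) (\<delta> i) (\<gamma> i) \<inter> {t i<..N}"
    define E where "E = {n. t i < n \<and> real n \<le> real (t i) + z i}"
    define G where "G = (\<lambda>(a, b). a + b) ` ({1..t i} \<times> {b \<in> B \<inter> {1..N}. y i < real b})"
    have K: "A' \<inter> {t i<..N} = K"
    proof (rule set_eqI)
      fix n
      show "n \<in> A' \<inter> {t i<..N} \<longleftrightarrow> n \<in> K"
        using A'_iff[of i n] N unfolding K_def by auto
    qed
    have sub: "U \<inter> {t i<..N} \<subseteq> K \<union> E \<union> G"
    proof
      fix n assume n: "n \<in> U \<inter> {t i<..N}"
      show "n \<in> K \<union> E \<union> G"
      proof (cases "n \<in> A'")
        case True
        then show ?thesis using n K by auto
      next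
        case False
        then obtain a b where ab: "a \<in> A" "b \<in> B" "n = a + b"
          using n by (auto simp: U_def set_plus_def)
        then obtain j where j: "t j < a" "a \<le> t (Suc j)" "a \<in> bohr (\<theta> j) 0 \<alpha>"
          by (auto simp: A_def)
        have nN: "t i < n" "n \<le> N" using n by auto
        have b0: "b \<ge> 1" using ab B by auto
        show ?thesis
        proof (cases "t i < a")
          case True
          have "a \<le> t (Suc i)" using ab nN N by simp
          then have "j = i" using index_unique[OF j(1,2) True] by simp
          moreover obtain p :: int where "\<bar>real b * \<theta> i - of_int p\<bar> \<le> \<delta> i"
            using near[of b i] ab nN N by auto
          ultimately have "n \<in> bohr (\<theta> i) (\<delta> i) (\<gamma> i)"
            using bohr_shift j(3) ab unfolding \<gamma>_def by blast
          then show ?thesis using nN by (auto simp: K_def)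
        next
          case False
          show ?thesis
          proof (cases "real b \<le> z i")
            case True
            then show ?thesis using False nN ab by (auto simp: E_def)
          next
            case nz: False
            then have "y i < real b" using gap[of b i] ab by auto
            then have "(a, b) \<in> {1..t i} \<times> {b \<in> B \<inter> {1..N}. y i < real b}"
              using False nN ab b0 j(1) by auto
            then show ?thesis unfolding G_def using ab by force
          qed
        qed
      qed
    qed
    have fin: "finite E" "finite G" "finite K"
    proof -
      have "E \<subseteq> {t i<..t i + nat \<lfloor>z i\<rfloor>}" by (auto simp: E_def) linarith
      then show "finite E" by (rule finite_subset) simp
    qed (auto simp: G_def K_def)
    have z0: "0 \<le> \<delta> i * real N" using \<delta>0[of i] by simp
    have E: "real (card E) \<le> \<delta> i * real N"
    proof -
      have "E \<subseteq> {t i<..t i + nat \<lfloor>z i\<rfloor>}" by (auto simp: E_def) linarith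
      then have "card E \<le> card {t i<..t i + nat \<lfloor>z i\<rfloor>}" by (rule card_mono[rotated]) simp
      then have "card E \<le> nat \<lfloor>z i\<rfloor>" by simp
      then have "real (card E) \<le> max 0 (z i)" by linarith
      moreover have "\<delta> i * real (t i) \<le> \<delta> i * real N" using N \<delta>0[of i] by simp
      ultimately show ?thesis using z[of i] z0 by linarith
    qed
    have G: "real (card G) \<le> \<delta> i * real N"
    proof (cases "y i \<le> real N")
      case True
      have "card G \<le> card ({1..t i} \<times> {b \<in> B \<inter> {1..N}. y i < real b})"
        unfolding G_def by (rule card_image_le) auto
      also have "\<dots> = t i * card {b \<in> B \<inter> {1..N}. y i < real b}" by (simp add: card_cartesian_product)
      also have "\<dots> \<le> t i * card (B \<inter> {1..N})" by (intro mult_left_mono card_mono) auto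
      finally have "real (card G) \<le> real (t i * card (B \<inter> {1..N}))" by (simp only: of_nat_le_iff)
      then show ?thesis using sparse[OF True] by simp
    next
      case False
      then have "G = {}" by (auto simp: G_def)
      then show ?thesis using z0 by simp
    qed
    have "card (U \<inter> {t i<..N}) \<le> card (K \<union> E \<union> G)"
      using sub fin by (intro card_mono) auto
    also have "\<dots> \<le> card K + card E + card G"
      using card_Un_le[of K E] card_Un_le[of "K \<union> E" G] by linarith
    finally have up: "real (card (U \<inter> {t i<..N})) \<le> real (card K) + 2 * (\<delta> i * real N)"
      using E G by linarith
    have "card K \<le> card (U \<inter> {t i<..N})" unfolding K[symmetric] U_def by (intro card_mono) auto
    then have low: "real (card K) \<le> real (card (U \<inter> {t i<..N}))" by simp
    have \<gamma>: "0 \<le> \<gamma> i" "\<gamma> i \<le> 1" using \<alpha> \<delta>0[of i] by (auto simp: \<gamma>_def)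
    have Kc: "\<bar>real (card K) - \<gamma> i * (real N - real (t i))\<bar> \<le> 10 * (\<delta> i * real N)"
      using card_bohr_block[OF \<gamma> \<theta>(1,2) N(1), of i "\<delta> i"] small[OF N(1)] unfolding K_def by linarith
    have "\<alpha> * (real N - real (t i)) \<le> \<gamma> i * (real N - real (t i))"
      using \<alpha> \<delta>0[of i] N by (intro mult_right_mono) (auto simp: \<gamma>_def)
    moreover have "\<gamma> i * (real N - real (t i)) \<le> (\<alpha> + 2 * \<delta> i) * (real N - real (t i))"
      using N by (intro mult_right_mono) (auto simp: \<gamma>_def)
    moreover have "2 * \<delta> i * (real N - real (t i)) \<le> 2 * \<delta> i * real N"
      using \<delta>0[of i] by (intro mult_left_mono) auto
    ultimately have "\<alpha> * (real N - real (t i)) \<le> \<gamma> i * (real N - real (t i))"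
       "\<gamma> i * (real N - real (t i)) \<le> \<alpha> * (real N - real (t i)) + 2 * (\<delta> i * real N)"
      by (simp_all add: distrib_right)
    then show "\<bar>real (card (U \<inter> {t i<..N})) - \<alpha> * (real N - real (t i))\<bar> \<le> 14 * \<delta> i * real N"
      using Kc low up z0 by (simp add: abs_le_iff)
  qed
  have "has_density (A + B) \<alpha>"
  proof -
    obtain b where b: "b \<in> B" using B by auto
    \<comment> \<open>\<open>A + B\<close> contains the translate of \<open>A\<close> by a single
      \<open>b\<close>, and truncating at \<open>n\<close> loses at most \<open>b\<close> elements,
      which vanishes in the density.\<close>
    have lower: "real (card (A \<inter> {1..n})) \<le> real (card ((A + B) \<inter> {1..n})) + real b" for n
    proof -
      have "A \<inter> {1..n} \<subseteq> (A \<inter> {1..n - b}) \<union> {n - b<..n}" by auto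
      then have "card (A \<inter> {1..n}) \<le> card ((A \<inter> {1..n - b}) \<union> {n - b<..n})"
        by (intro card_mono) auto
      also have "\<dots> \<le> card (A \<inter> {1..n - b}) + card {n - b<..n}" by (rule card_Un_le)
      finally have "card (A \<inter> {1..n}) \<le> card (A \<inter> {1..n - b}) + b" by simp
      moreover have "card (A \<inter> {1..n - b}) = card ((\<lambda>a. a + b) ` (A \<inter> {1..n - b}))"
        by (rule card_image[symmetric]) auto
      moreover have "\<dots> \<le> card ((A + B) \<inter> {1..n})"
        using b by (intro card_mono) (auto simp: set_plus_def)
      ultimately show ?thesis by linarith
    qed
    show ?thesis unfolding has_density_def
    proof (rule tendsto_sandwich)
      show "\<forall>\<^sub>F n in sequentially. real (card (A \<inter> {1..n})) / real n - real b / real n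
          \<le> real (card ((A + B) \<inter> {1..n})) / real n"
      proof (intro always_eventually allI)
        fix n show "real (card (A \<inter> {1..n})) / real n - real b / real n
            \<le> real (card ((A + B) \<inter> {1..n})) / real n"
          using divide_right_mono[OF lower[of n], of "real n"] by (simp add: add_divide_distrib)
      qed
      show "\<forall>\<^sub>F n in sequentially. real (card ((A + B) \<inter> {1..n})) / real n
          \<le> real (card (U \<inter> {1..n})) / real n"
        by (intro always_eventually allI divide_right_mono of_nat_mono card_mono) (auto simp: U_def)
      show "(\<lambda>n. real (card (U \<inter> {1..n})) / real n) \<longlonglongrightarrow> \<alpha>"
        using U_density unfolding has_density_def .
      have "(\<lambda>n. real b / real n) \<longlonglongrightarrow> 0" by (rule lim_const_over_n)
      from tendsto_diff[OF A_density[unfolded has_density_def] this]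
      show "(\<lambda>n. real (card (A \<inter> {1..n})) / real n - real b / real n) \<longlonglongrightarrow> \<alpha>" by simp
    qed
  qed
  moreover have "A \<subseteq> {1..}" by (auto simp: A_def)
  ultimately show ?thesis using A_density by blast
qed

section \<open>Counting function and gaps of \<open>B\<close> on a logarithmic scale\<close>

lemma x_over_ln_x_mono:
  fixes x y :: real
  assumes "exp 1 \<le> x" "x \<le> y"
  shows "x / ln x \<le> y / ln y"
proof -
  have pos: "0 < x" "1 \<le> ln x" "0 < y" using assms less_le_trans[OF exp_gt_zero assms(1)]
    by (auto simp: ln_ge_iff)
  have "ln x \<le> ln y" using pos assms by simp
  then have "0 < ln y" using pos by linarith
  moreover have "ln y * x \<le> ln x * y"
    using ln_x_over_x_mono[OF assms] pos by (simp add: field_simps)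
  moreover have "0 < ln x" using pos by linarith
  ultimately show ?thesis by (simp add: frac_le_eq divide_le_0_iff mult.commute)
qed

text \<open>The limsup hypothesis is read at \<open>n = \<lfloor>exp L\<rfloor>\<close>;
  monotonicity of \<open>x / ln x\<close> beyond \<open>exp 1\<close> allows \<open>ln n\<close> to
  be replaced by the larger \<open>L\<close>.\<close>

lemma counting_bound_exp:
  fixes B :: "nat set"
  assumes B: "B \<subseteq> {1..}" and lim: "limsup (\<lambda>n. ereal (real (card (B \<inter> {1..n})) * ln (ln (real n)) / ln (real n))) < 1"
  obtains c :: real where "0 < c" "c < 1"
    "\<forall>\<^sub>F L in at_top. real (card {b \<in> B. real b \<le> exp L}) \<le> c * L / ln L"
proof -
  obtain c0 where c0: "limsup (\<lambda>n. ereal (real (card (B \<inter> {1..n})) * ln (ln (real n)) / ln (real n))) < ereal c0"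
    "ereal c0 < 1" using ereal_dense2[OF lim] by blast
  \<comment> \<open>The maximum with 1/2 gives positivity at once and stays below 1.\<close>
  define c where "c = max c0 (1/2)"
  have c: "0 < c" "c < 1" using c0(2) by (auto simp: c_def one_ereal_def)
  have "\<forall>\<^sub>F n in sequentially. real (card (B \<inter> {1..n})) * ln (ln (real n)) / ln (real n) < c0"
    using Limsup_lessD[OF c0(1)] by simp
  moreover have "\<forall>\<^sub>F n in sequentially. exp 1 \<le> ln (real n)" by real_asymp
  ultimately have ev: "\<forall>\<^sub>F n in sequentially. real (card (B \<inter> {1..n})) \<le> c * (ln (real n) / ln (ln (real n)))
      \<and> exp 1 \<le> ln (real n)"
  proof eventually_elim
    case (elim n)
    have p: "0 < ln (real n)" using less_le_trans[OF exp_gt_zero elim(2)] .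
    then have q: "1 \<le> ln (ln (real n))" using elim(2) by (simp add: ln_ge_iff)
    have "real (card (B \<inter> {1..n})) * ln (ln (real n)) / ln (real n) \<le> c"
      using elim(1) by (simp add: c_def)
    then have "real (card (B \<inter> {1..n})) * ln (ln (real n)) \<le> c * ln (real n)"
      using p by (simp only: pos_divide_le_eq)
    moreover have "0 < ln (ln (real n))" using q by linarith
    ultimately show ?case using elim(2) by (simp only: times_divide_eq_right pos_le_divide_eq)
  qed
  have lim_floor: "filterlim (\<lambda>L::real. nat \<lfloor>exp L\<rfloor>) sequentially at_top"
    by (rule filterlim_compose[OF filterlim_nat_sequentially filterlim_compose[OF filterlim_floor_sequentially exp_at_top]])
  have "\<forall>\<^sub>F L::real in at_top. real (card (B \<inter> {1..nat \<lfloor>exp L\<rfloor>}))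
      \<le> c * (ln (real (nat \<lfloor>exp L\<rfloor>)) / ln (ln (real (nat \<lfloor>exp L\<rfloor>)))) \<and> exp 1 \<le> ln (real (nat \<lfloor>exp L\<rfloor>))"
    by (rule eventually_compose_filterlim[OF ev lim_floor])
  then have "\<forall>\<^sub>F L in at_top. real (card {b \<in> B. real b \<le> exp L}) \<le> c * L / ln L"
  proof eventually_elim
    case (elim L)
    define n where "n = nat \<lfloor>exp L\<rfloor>"
    have "{b \<in> B. real b \<le> exp L} = B \<inter> {1..n}"
      using B by (auto simp: n_def le_nat_floor) linarith
    moreover have "ln (real n) \<le> L"
    proof -
      have "0 < ln (real n)" using less_le_trans[OF exp_gt_zero conjunct2[OF elim]] by (simp add: n_def)
      then have "0 < real n" by (cases "n = 0") auto
      moreover have "real n \<le> exp L" by (simp add: n_def)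
      ultimately have "ln (real n) \<le> ln (exp L)" by (subst ln_le_cancel_iff) auto
      then show ?thesis by simp
    qed
    then have "ln (real n) / ln (ln (real n)) \<le> L / ln L"
      using elim by (intro x_over_ln_x_mono) (auto simp: n_def)
    then have "c * (ln (real n) / ln (ln (real n))) \<le> c * (L / ln L)"
      using c by (intro mult_left_mono) auto
    ultimately show ?case using elim unfolding n_def by simp
  qed
  with c that show thesis by blast
qed

text \<open>Cut \<open>[exp (L / C), exp L]\<close> into geometric cells of ratio \<open>L powr p\<close> with \<open>1 < p < 1 / c\<close>: for \<open>C\<close>
  large there are more cells than elements of \<open>B\<close>, so some cell contains none.\<close>

lemma exists_wide_gap:
  fixes B :: "nat set"
  assumes c: "0 < c" "c < 1"
    and count: "\<forall>\<^sub>F L in at_top. real (card {b \<in> B. real b \<le> exp L}) \<le> c * L / ln L"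
  obtains C q :: real where "1 < C" "0 < q"
    "\<forall>\<^sub>F L in at_top. \<exists>w. exp (L / C) \<le> w \<and> w * L powr (1 + 2 * q) \<le> exp L \<and>
       (\<forall>b\<in>B. real b \<le> w \<or> w * L powr (1 + 2 * q) < real b)"
proof -
  \<comment> \<open>Here \<open>p\<close> is the midpoint of 1 and \<open>1 / c\<close>, and
    \<open>1 / C = (1 - c * p) / 2\<close> ensures \<open>c * p < 1 - 1 / C\<close>. The number of
    cells is about \<open>\<kappa> * (L / ln L)\<close>, the log-length \<open>L - L / C\<close>
    divided by the log-length \<open>p * ln L\<close> of one cell; it exceeds the count of
    \<open>B\<close> because \<open>c < \<kappa>\<close>.\<close>
  define q where "q = (1 / c - 1) / 4"
  define p where "p = 1 + 2 * q"
  define C where "C = 2 / (1 - c * p)"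
  define \<kappa> where "\<kappa> = (1 - 1 / C) / p"
  have q: "0 < q" using c by (simp add: q_def)
  have cp: "c * p = (1 + c) / 2" using c by (simp add: p_def q_def field_simps)
  have C: "1 < C" using c unfolding C_def cp by (simp add: field_simps)
  have p: "1 < p" using q by (simp add: p_def)
  have "c * p < 1 - 1 / C" using c unfolding C_def cp by (simp add: field_simps)
  then have \<kappa>: "c < \<kappa>" using p by (simp add: \<kappa>_def field_simps)
  \<comment> \<open>One spare cell, to absorb the rounding down in \<open>J\<close>.\<close>
  have "\<forall>\<^sub>F L in at_top. 1 \<le> (\<kappa> - c) * (L / ln L)" using \<kappa> by real_asymp
  then have "\<forall>\<^sub>F L in at_top. \<exists>w. exp (L / C) \<le> w \<and> w * L powr p \<le> exp L \<and>
       (\<forall>b\<in>B. real b \<le> w \<or> w * L powr p < real b)"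
    using count eventually_gt_at_top[of 1]
  proof eventually_elim
    case (elim L)
    have lnL: "0 < ln L" using elim(3) by simp
    define R where "R = L powr p"
    define J where "J = nat \<lfloor>\<kappa> * (L / ln L)\<rfloor>"
    define w where "w j = exp (L / C) * R ^ j" for j
    have R: "1 < R" using elim(3) p by (simp add: R_def)
    have w_mono: "w i \<le> w j" if "i \<le> j" for i j using that R by (simp add: w_def power_increasing)
    have w_Suc: "w (Suc j) = w j * R" for j by (simp add: w_def)
    have nonneg: "0 \<le> \<kappa> * (L / ln L)" using \<kappa> c elim(3) lnL by simp
    have "R ^ J = exp (real J * (p * ln L))"
      using elim(3) by (simp add: R_def powr_def exp_of_nat_mult)
    also have "real J * (p * ln L) \<le> \<kappa> * (L / ln L) * (p * ln L)"
      using nonneg p lnL by (intro mult_right_mono) (auto simp: J_def)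
    also have "\<dots> = L - L / C" using p lnL C by (simp add: \<kappa>_def field_simps)
    finally have "w J \<le> exp (L / C) * exp (L - L / C)" by (simp add: w_def)
    also have "\<dots> = exp L" by (simp add: exp_add[symmetric])
    finally have wJ: "w J \<le> exp L" .
    have cardJ: "card {b \<in> B. real b \<le> exp L} < J"
    proof -
      have "\<kappa> * (L / ln L) < real J + 1" unfolding J_def using nonneg by linarith
      moreover have "c * L / ln L = c * (L / ln L)" by simp
      ultimately have "real (card {b \<in> B. real b \<le> exp L}) < real J"
        using elim(1,2) by (simp only: left_diff_distrib)
      then show ?thesis by simp
    qed
    have "\<exists>j<J. \<forall>b\<in>B. real b \<le> w j \<or> w (Suc j) < real b"
    proof (rule ccontr)
      assume "\<not> ?thesis"
      then have "\<forall>j. j < J \<longrightarrow> (\<exists>b\<in>B. w j < real b \<and> real b \<le> w (Suc j))" 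
        by (metis not_le)
      then obtain f where f: "\<And>j. j < J \<Longrightarrow> f j \<in> B \<and> w j < real (f j) \<and> real (f j) \<le> w (Suc j)"
        by metis
      have less: "f i < f j" if "i < j" "j < J" for i j
      proof -
        have "real (f i) \<le> w (Suc i)" using f[of i] that by auto
        also have "\<dots> \<le> w j" using that by (intro w_mono) auto
        also have "\<dots> < real (f j)" using f[of j] that by auto
        finally show ?thesis by simp
      qed
      have "inj_on f {..<J}" using less by (intro linorder_inj_onI) force+
      moreover have "f ` {..<J} \<subseteq> {b \<in> B. real b \<le> exp L}"
      proof -
        have "real (f j) \<le> exp L" if "j < J" for j
          using f[OF that] w_mono[of "Suc j" J] that wJ by auto
        then show ?thesis using f by auto
      qed
      moreover have "finite {b \<in> B. real b \<le> exp L}"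
        by (rule finite_subset[of _ "{..nat \<lfloor>exp L\<rfloor>}"]) (auto simp: le_nat_floor)
      ultimately have "card {..<J} \<le> card {b \<in> B. real b \<le> exp L}" by (intro card_inj_on_le)
      with cardJ show False by simp
    qed
    then obtain j where j: "j < J" "\<forall>b\<in>B. real b \<le> w j \<or> w (Suc j) < real b" by blast
    have "exp (L / C) \<le> w j" using w_mono[of 0 j] by (simp add: w_def)
    moreover have "w (Suc j) \<le> exp L" using w_mono[of "Suc j" J] j wJ by auto
    ultimately show ?case using j unfolding w_Suc R_def by blast
  qed
  with C q that show thesis unfolding p_def by blast
qed

section \<open>Simultaneous approximation\<close>

text \<open>Dirichlet's theorem is applied to the numbers \<open>b / M\<close> with quality
  \<open>1 / Q\<close>, \<open>Q\<close> about \<open>ln L\<close>. The multiplier \<open>r\<close>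
  lies between 1 and \<open>Q ^ k\<close>, where \<open>k = O(L / ln L)\<close> counts the relevant
  \<open>b\<close>, so \<open>Q ^ k = exp (o(L))\<close>. Hence \<open>\<theta> = r / M\<close>
  exceeds \<open>1 / M\<close>, the lower end of the window, by at most a subexponential
  factor.\<close>

lemma exists_simultaneous_rotation:
  fixes B :: "nat set"
  assumes C: "0 < C" and D: "0 < D" and c: "0 < c"
    and count: "\<forall>\<^sub>F L in at_top. real (card {b \<in> B. real b \<le> exp L}) \<le> c * L / ln L"
  shows "\<forall>\<^sub>F L in at_top. \<exists>\<theta>. exp (- L / (2 * C)) \<le> \<theta> \<and> \<theta> \<le> exp (- L / (4 * C)) \<and>
    (\<forall>b\<in>B. real b \<le> exp (D * L) \<longrightarrow> (\<exists>p::int. \<bar>real b * \<theta> - of_int p\<bar> \<le> 1 / ln L))"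
proof -
  have "filterlim (\<lambda>L. D * L) at_top at_top" using D by real_asymp
  from eventually_compose_filterlim[OF count this]
  have "\<forall>\<^sub>F L in at_top. real (card {b \<in> B. real b \<le> exp (D * L)}) \<le> c * (D * L) / ln (D * L)" .
  \<comment> \<open>The left side will bound \<open>k * ln Q\<close>; its order is
    \<open>L * ln (ln L) / ln L\<close>, which is \<open>o(L)\<close>.\<close>
  moreover have "\<forall>\<^sub>F L in at_top. c * (D * L) / ln (D * L) * ln (ln L + 1) \<le> L / (4 * C)"
    using C D c by real_asymp
  moreover have "\<forall>\<^sub>F L::real in at_top. 1 \<le> ln L" by real_asymp
  ultimately show ?thesis
  proof eventually_elim
    case (elim L)
    define S where "S = {b \<in> B. real b \<le> exp (D * L)}"
    define k where "k = card S"
    define M where "M = exp (L / (2 * C))"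
    define Q where "Q = nat \<lceil>ln L\<rceil>"
    have Q: "ln L \<le> real Q" "real Q \<le> ln L + 1" "1 \<le> real Q" unfolding Q_def using elim(3) by linarith+
    have "finite S" unfolding S_def
      by (rule finite_subset[of _ "{..nat \<lfloor>exp (D * L)\<rfloor>}"]) (auto simp: le_nat_floor)
    then obtain e where e: "bij_betw e {0..<k} S" unfolding k_def by (metis ex_bij_betw_nat_finite)
    obtain r p where r: "0 < r" "r \<le> int (Q ^ k)"
      and rp: "\<And>i. i < k \<Longrightarrow> \<bar>of_int r * (real (e i) / M) - of_int (p i)\<bar> < 1 / real Q"
      using Dirichlet_approx_simult[of Q k "\<lambda>i. real (e i) / M"] Q by auto
    define \<theta> where "\<theta> = of_int r / M"
    have "of_int r \<le> real Q ^ k" using r by (metis of_int_le_iff of_int_of_nat_eq of_nat_power)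
    also have "\<dots> = exp (real k * ln (real Q))" using Q by (simp add: exp_of_nat_mult)
    also have "real k * ln (real Q) \<le> c * (D * L) / ln (D * L) * ln (ln L + 1)"
      using elim Q by (intro mult_mono) (auto simp: k_def S_def)
    also have "\<dots> \<le> L / (4 * C)" by (rule elim(2))
    finally have "of_int r \<le> exp (L / (4 * C))" by simp
    then have "\<theta> \<le> exp (L / (4 * C)) / M" by (simp add: \<theta>_def M_def divide_right_mono)
    also have "\<dots> = exp (- L / (4 * C))" using C by (simp add: M_def exp_diff[symmetric] field_simps)
    finally have 1: "\<theta> \<le> exp (- L / (4 * C))" .
    have "1 / M \<le> \<theta>" using r by (simp add: \<theta>_def M_def divide_right_mono)
    then have 2: "exp (- L / (2 * C)) \<le> \<theta>" by (simp add: M_def exp_minus field_simps)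
    have 3: "\<exists>p::int. \<bar>real b * \<theta> - of_int p\<bar> \<le> 1 / ln L" if b: "b \<in> B" "real b \<le> exp (D * L)" for b
    proof -
      obtain i where i: "i < k" "b = e i" using e b by (force simp: S_def bij_betw_def)
      have "\<bar>real b * \<theta> - of_int (p i)\<bar> < 1 / real Q" using rp[OF i(1)] i(2) by (simp add: \<theta>_def mult.commute)
      also have "\<dots> \<le> 1 / ln L" using Q elim(3) by (intro divide_left_mono) auto
      finally show ?thesis by (intro exI[of _ "p i"]) simp
    qed
    show ?case using 1 2 3 by blast
  qed
qed

section \<open>Choice of the cut and the rotation at one scale\<close>

text \<open>The cut \<open>t\<close> sits at about \<open>w * L powr q\<close> in a gap from
  \<open>w\<close> to \<open>w * L powr (1 + 2 * q)\<close>. The margin \<open>L powr q\<close>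
  below beats \<open>ln L\<close>, so \<open>w\<close> is negligible against \<open>t\<close>. The
  margin of order \<open>L powr (1 + q)\<close> above absorbs a factor \<open>L\<close> from
  counting \<open>B\<close> and still beats \<open>ln L\<close>. The range
  \<open>exp (C\<^sup>2 * L)\<close> anticipates the next scale
  \<open>C\<^sup>2 * L\<close>.\<close>

lemma exists_scale:
  fixes B :: "nat set"
  assumes B: "B \<subseteq> {1..}" and c: "0 < c" "c < 1"
    and count: "\<forall>\<^sub>F L in at_top. real (card {b \<in> B. real b \<le> exp L}) \<le> c * L / ln L"
  obtains C :: real where "1 < C"
    "\<forall>\<^sub>F L in at_top. \<exists>t z y \<theta>. exp (L / C) \<le> real t \<and> real t \<le> exp L \<and>
       (\<forall>b\<in>B. real b \<le> z \<or> y < real b) \<and> z \<le> 1 / ln L * real t \<and>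
       (\<forall>N. y \<le> real N \<longrightarrow> real t * real (card (B \<inter> {1..N})) \<le> 1 / ln L * real N) \<and>
       0 < \<theta> \<and> \<theta> \<le> 1 / ln L \<and> 1 / \<theta> \<le> 1 / ln L * real t \<and>
       (\<forall>b\<in>B. real b \<le> exp (C\<^sup>2 * L) \<longrightarrow> (\<exists>p::int. \<bar>real b * \<theta> - of_int p\<bar> \<le> 1 / ln L))"
proof -
  obtain C q where C: "1 < C" and q: "0 < q" and
    gap: "\<forall>\<^sub>F L in at_top. \<exists>w. exp (L / C) \<le> w \<and> w * L powr (1 + 2 * q) \<le> exp L \<and>
       (\<forall>b\<in>B. real b \<le> w \<or> w * L powr (1 + 2 * q) < real b)"
    using exists_wide_gap[OF c count] by blast
  have "0 < C" "0 < C\<^sup>2" using C by auto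
  note rot = exists_simultaneous_rotation[OF this c(1) count]
  obtain L0 where L0: "\<And>L. L \<ge> L0 \<Longrightarrow> real (card {b \<in> B. real b \<le> exp L}) \<le> c * L / ln L"
    using count by (auto simp: eventually_at_top_linorder)
  \<comment> \<open>Every \<open>N \<ge> y\<close> below has \<open>ln N \<ge> L / C\<close>, so the
    counting bound applies at \<open>ln N\<close>, with a denominator of at least 1.\<close>
  have "\<forall>\<^sub>F L in at_top. L0 \<le> L / C" "\<forall>\<^sub>F L in at_top. exp 1 \<le> L / C"
    using \<open>0 < C\<close> by real_asymp+
  moreover have "\<forall>\<^sub>F L in at_top. 2 * ln L \<le> L powr q" using q by real_asymp
  moreover have "\<forall>\<^sub>F L in at_top. ln L \<le> exp (L / (4 * C))" using \<open>0 < C\<close> by real_asymp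
  moreover have "\<forall>\<^sub>F L in at_top. ln L \<le> exp (L / (2 * C))" using \<open>0 < C\<close> by real_asymp
  moreover have "\<forall>\<^sub>F L::real in at_top. exp 1 \<le> L" by real_asymp
  ultimately have "\<forall>\<^sub>F L in at_top. \<exists>t z y \<theta>. exp (L / C) \<le> real t \<and> real t \<le> exp L \<and>
       (\<forall>b\<in>B. real b \<le> z \<or> y < real b) \<and> z \<le> 1 / ln L * real t \<and>
       (\<forall>N. y \<le> real N \<longrightarrow> real t * real (card (B \<inter> {1..N})) \<le> 1 / ln L * real N) \<and>
       0 < \<theta> \<and> \<theta> \<le> 1 / ln L \<and> 1 / \<theta> \<le> 1 / ln L * real t \<and>
       (\<forall>b\<in>B. real b \<le> exp (C\<^sup>2 * L) \<longrightarrow> (\<exists>p::int. \<bar>real b * \<theta> - of_int p\<bar> \<le> 1 / ln L))"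
    using gap rot
  proof eventually_elim
    case (elim L)
    obtain w where w: "exp (L / C) \<le> w" "w * L powr (1 + 2 * q) \<le> exp L"
      "\<forall>b\<in>B. real b \<le> w \<or> w * L powr (1 + 2 * q) < real b" using elim(7) by blast
    obtain \<theta> where \<theta>: "exp (- L / (2 * C)) \<le> \<theta>" "\<theta> \<le> exp (- L / (4 * C))"
      "\<forall>b\<in>B. real b \<le> exp (C\<^sup>2 * L) \<longrightarrow> (\<exists>p::int. \<bar>real b * \<theta> - of_int p\<bar> \<le> 1 / ln L)"
      using elim(8) by blast
    define P where "P = L powr q"
    define y where "y = w * L powr (1 + 2 * q)"
    define t where "t = nat \<lceil>w * P\<rceil>"
    have L: "1 < L" using elim(6) less_le_trans[of 1 "exp 1 :: real" L] by simp
    have lnL: "1 \<le> ln L" using elim(6) L by (simp add: ln_ge_iff)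
    have P: "2 * ln L \<le> P" "2 \<le> P" using elim(3) lnL by (simp_all add: P_def)
    have y: "y = w * P * (L * P)" 
    proof -
      have "L powr (1 + 2 * q) = L powr 1 * (L powr q * L powr q)"
        by (simp only: powr_add[symmetric] mult_2)
      then show ?thesis using L by (simp add: y_def P_def)
    qed
    have LC: "1 \<le> L / C" using elim(2) less_le_trans[of 1 "exp 1 :: real" "L / C"] by simp
    have w0: "1 \<le> w" using w(1) LC by (meson one_le_exp_iff order_trans zero_le_one)
    have wP: "1 \<le> w * P" using mult_mono[of 1 w 1 P] w0 P by simp
    have t: "w * P \<le> real t" "real t \<le> 2 * (w * P)" unfolding t_def using wP by linarith+
    have LP: "2 \<le> L * P" using mult_mono[of 1 L 2 P] L P by simp
    have "w * 1 \<le> w * P" using w0 P by (intro mult_left_mono) auto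
    then have w1: "exp (L / C) \<le> w * P" using w(1) by linarith
    then have t1: "exp (L / C) \<le> real t" using t(1) by linarith
    have "2 * (w * P) \<le> y" unfolding y using mult_left_mono[OF LP, of "w * P"] wP by simp
    then have t2: "real t \<le> exp L" using t(2) w(2) by (simp add: y_def)
    have t3: "w \<le> 1 / ln L * real t"
    proof -
      have "w * ln L \<le> w * P" using P lnL w0 by (intro mult_left_mono) auto
      then show ?thesis using t(1) lnL by (simp add: field_simps)
    qed
    have yw: "exp (L / C) \<le> y" using \<open>2 * (w * P) \<le> y\<close> w1 wP by linarith
    then have y1: "exp 1 \<le> y" using LC by (meson exp_le_cancel_iff order_trans)
    then have ypos: "0 < y" using less_le_trans[OF exp_gt_zero] by blast
    \<comment> \<open>The crude count \<open>ln N\<close> is enough: \<open>ln x / x\<close>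
      decreases beyond \<open>exp 1\<close>, so the proportion of \<open>B\<close> up to
      \<open>N\<close> is at most \<open>ln y / y \<le> L / y\<close>, and
      \<open>t * L / y \<le> 2 / P \<le> 1 / ln L\<close>.\<close>
    have sparse: "real t * real (card (B \<inter> {1..N})) \<le> 1 / ln L * real N" if N: "y \<le> real N" for N
    proof -
      have N0: "0 < real N" using N ypos by linarith
      have lnN: "L / C \<le> ln (real N)" using N yw N0 by (simp add: ln_ge_iff)
      then have "exp 1 \<le> ln (real N)" using elim(2) by linarith
      then have ll: "1 \<le> ln (ln (real N))" using less_le_trans[OF exp_gt_zero] by (subst ln_ge_iff) blast+
      have "B \<inter> {1..N} = {b \<in> B. real b \<le> exp (ln (real N))}" using B N0 by auto
      then have "real (card (B \<inter> {1..N})) \<le> c * ln (real N) / ln (ln (real N))"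
        using L0[of "ln (real N)"] lnN elim(1) by simp
      also have "\<dots> \<le> 1 * ln (real N) / 1"
        using c ll lnN LC by (intro frac_le mult_right_mono) auto
      finally have "real (card (B \<inter> {1..N})) \<le> ln (real N) / real N * real N" using N0 by simp
      also have "\<dots> \<le> ln y / y * real N"
        using ln_x_over_x_mono[OF y1 N] N0 by (intro mult_right_mono) auto
      also have "\<dots> \<le> L / y * real N"
      proof -
        have "ln y \<le> L" using w(2) ypos ln_le_cancel_iff[of y "exp L"] by (simp add: y_def)
        then show ?thesis using ypos by (intro mult_right_mono divide_right_mono) auto
      qed
      finally have "real t * real (card (B \<inter> {1..N})) \<le> 2 * (w * P) * (L / y * real N)"
        using t(2) wP by (intro mult_mono) auto
      also have "\<dots> = 2 / P * real N" using wP P L w0 by (simp add: y)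
      also have "\<dots> \<le> 1 / ln L * real N"
        using P lnL by (intro mult_right_mono) (auto simp: field_simps)
      finally show ?thesis .
    qed
    have \<theta>0: "0 < \<theta>" using \<theta>(1) less_le_trans[OF exp_gt_zero] by blast
    have "exp (- L / (4 * C)) \<le> 1 / ln L"
      using elim(4) lnL by (simp add: exp_minus field_simps)
    then have \<theta>1: "\<theta> \<le> 1 / ln L" using \<theta>(2) by linarith
    \<comment> \<open>The bound for \<open>1 / \<theta>\<close> is the square root of
      \<open>exp (L / C) \<le> t\<close>; the other square root absorbs \<open>ln L\<close>.\<close>
    have "1 / \<theta> \<le> 1 / exp (- L / (2 * C))" using \<theta>(1) \<theta>0 by (intro divide_left_mono) auto
    also have "\<dots> = exp (L / (2 * C))" by (simp add: exp_minus field_simps)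
    also have "\<dots> = 1 / ln L * (ln L * exp (L / (2 * C)))" using lnL by simp
    also have "\<dots> \<le> 1 / ln L * (exp (L / (2 * C)) * exp (L / (2 * C)))"
      using elim(5) lnL by (intro mult_left_mono mult_right_mono) auto
    also have "exp (L / (2 * C)) * exp (L / (2 * C)) = exp (L / C)" by (simp flip: exp_add)
    also have "1 / ln L * exp (L / C) \<le> 1 / ln L * real t"
      using t1 lnL by (intro mult_left_mono) auto
    finally have \<theta>2: "1 / \<theta> \<le> 1 / ln L * real t" .
    show ?case
      using t1 t2 t3 w(3) sparse \<theta>0 \<theta>1 \<theta>2 \<theta>(3) unfolding y_def[symmetric]
      by (intro exI[of _ t] exI[of _ w] exI[of _ y] exI[of _ \<theta>]) blast
  qed
  with C that show thesis by blast
qed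

section \<open>Assembly along a geometric sequence of scales\<close>

theorem theorem1p9:
  fixes B :: "nat set" and \<alpha> :: real
  assumes "B \<subseteq> {1..}"
    and "infinite B"
    and "limsup (\<lambda>n. ereal (real (card (B \<inter> {1..n})) * ln (ln (real n)) / ln (real n))) < 1"
    and "\<alpha> \<in> {0..1}"
  shows "\<exists>A. A \<subseteq> {1..} \<and> has_density A \<alpha> \<and> has_density (A + B) \<alpha>"
proof -
  obtain c where c: "0 < c" "c < 1"
    and count: "\<forall>\<^sub>F L in at_top. real (card {b \<in> B. real b \<le> exp L}) \<le> c * L / ln L"
    using counting_bound_exp[OF assms(1,3)] by blast
  define scale where "scale C L t z y \<theta> \<longleftrightarrow> exp (L / C) \<le> real t \<and> real t \<le> exp L \<and>
       (\<forall>b\<in>B. real b \<le> z \<or> y < real b) \<and> z \<le> 1 / ln L * real t \<and>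
       (\<forall>N. y \<le> real N \<longrightarrow> real t * real (card (B \<inter> {1..N})) \<le> 1 / ln L * real N) \<and>
       0 < \<theta> \<and> \<theta> \<le> 1 / ln L \<and> 1 / \<theta> \<le> 1 / ln L * real t \<and>
       (\<forall>b\<in>B. real b \<le> exp (C\<^sup>2 * L) \<longrightarrow> (\<exists>p::int. \<bar>real b * \<theta> - of_int p\<bar> \<le> 1 / ln L))"
    for C L :: real and t :: nat and z y \<theta> :: real
  obtain C where C: "1 < C" and ev: "\<forall>\<^sub>F L in at_top. \<exists>t z y \<theta>. scale C L t z y \<theta>"
    using exists_scale[OF assms(1) c count] unfolding scale_def by blast
  have "\<forall>\<^sub>F L in at_top. ln L \<le> exp ((C - 1) * L)" using C by real_asymp
  \<comment> \<open>This gives \<open>ln L \<ge> 2\<close>, whence the strict bound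
    \<open>\<theta> i < 1\<close>.\<close>
  moreover have "\<forall>\<^sub>F L::real in at_top. exp 2 \<le> L" by real_asymp
  ultimately have "\<forall>\<^sub>F L in at_top. (\<exists>t z y \<theta>. scale C L t z y \<theta>) \<and>
      ln L \<le> exp ((C - 1) * L) \<and> exp 2 \<le> L"
    using ev by eventually_elim blast
  then obtain L0 where L0: "\<And>L. L \<ge> L0 \<Longrightarrow> (\<exists>t z y \<theta>. scale C L t z y \<theta>) \<and>
      ln L \<le> exp ((C - 1) * L) \<and> exp 2 \<le> L"
    unfolding eventually_at_top_linorder by blast
  have L0_pos: "0 < L0" using L0[of L0] less_le_trans[OF exp_gt_zero[of 2], of L0] by blast
  have C2: "1 < C\<^sup>2" using C by (simp add: one_less_power)
  \<comment> \<open>The cut \<open>t i\<close> is only located between \<open>exp (l i / C)\<close>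
    and \<open>exp (l i)\<close>. With ratio \<open>C\<^sup>2\<close>, the next cut is at least
    \<open>exp (C * l i)\<close>, outgrowing \<open>t i\<close> by a factor
    \<open>exp ((C - 1) * l i)\<close>, and at most \<open>exp (C\<^sup>2 * l i)\<close>, the range
    where \<open>\<theta> i\<close> works.\<close>
  define l where "l i = L0 * (C\<^sup>2) ^ i" for i
  have l_ge: "L0 \<le> l i" for i using L0_pos C2 by (simp add: l_def)
  have l_Suc: "l (Suc i) = C\<^sup>2 * l i" for i by (simp add: l_def)
  have l_pos: "0 < l i" for i using l_ge[of i] L0_pos by linarith
  have ln_l: "2 \<le> ln (l i)" for i using L0[OF l_ge[of i]] l_pos[of i] by (simp add: ln_ge_iff)
  define \<delta> where "\<delta> i = 1 / ln (l i)" for i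
  have "filterlim (\<lambda>i. L0 * D ^ i) at_top sequentially" if "1 < D" for D :: real
    using L0_pos that by real_asymp
  then have "filterlim l at_top sequentially" using C2 unfolding l_def by blast
  then have "filterlim (\<lambda>i. ln (l i)) at_top sequentially" by (rule filterlim_compose[OF ln_at_top])
  then have \<delta>: "\<delta> \<longlonglongrightarrow> 0"
    unfolding \<delta>_def by (intro tendsto_divide_0[OF tendsto_const] filterlim_at_top_imp_at_infinity)
  have "\<forall>i. \<exists>t z y \<theta>. scale C (l i) t z y \<theta>" using L0[OF l_ge] by blast
  then obtain t z y \<theta> where S: "\<And>i. scale C (l i) (t i) (z i) (y i) (\<theta> i)" by metis
  have next_ge: "exp (C * l i) \<le> real (t (Suc i))" for i
  proof -
    have "l (Suc i) / C = C * l i" using C by (simp add: l_Suc power2_eq_square)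
    then show ?thesis using S[of "Suc i"] unfolding scale_def by metis
  qed
  have growth: "real (t i) \<le> \<delta> i * real (t (Suc i))" for i
  proof -
    have "real (t i) \<le> exp (l i)" using S[of i] unfolding scale_def by blast
    also have "\<dots> = \<delta> i * (ln (l i) * exp (l i))" using ln_l[of i] by (simp add: \<delta>_def)
    also have "\<dots> \<le> \<delta> i * (exp ((C - 1) * l i) * exp (l i))"
      using L0[OF l_ge[of i]] ln_l[of i] by (intro mult_left_mono mult_right_mono) (auto simp: \<delta>_def)
    also have "exp ((C - 1) * l i) * exp (l i) = exp (C * l i)"
      by (simp flip: exp_add add: algebra_simps)
    also have "\<delta> i * exp (C * l i) \<le> \<delta> i * real (t (Suc i))"
      using next_ge[of i] ln_l[of i] by (intro mult_left_mono) (auto simp: \<delta>_def)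
    finally show ?thesis .
  qed
  have "strict_mono t"
  proof (rule strict_monoI_Suc)
    fix i
    have "real (t i) \<le> exp (l i)" using S[of i] unfolding scale_def by blast
    also have "\<dots> < exp (C * l i)" using C l_pos[of i] by simp
    also note next_ge
    finally show "t i < t (Suc i)" by simp
  qed
  moreover have "\<theta> i < 1" for i
  proof -
    have "\<theta> i \<le> 1 / ln (l i)" using S[of i] unfolding scale_def by blast
    also have "\<dots> < 1" using ln_l[of i] by simp
    finally show ?thesis .
  qed
  moreover have "\<exists>p::int. \<bar>real b * \<theta> i - of_int p\<bar> \<le> \<delta> i" if "b \<in> B" "b \<le> t (Suc i)" for i b
  proof -
    have "real b \<le> real (t (Suc i))" using that by simp
    also have "\<dots> \<le> exp (C\<^sup>2 * l i)" using S[of "Suc i"] unfolding scale_def l_Suc by blast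
    finally show ?thesis using S[of i] that(1) unfolding scale_def \<delta>_def by blast
  qed
  moreover have "B \<noteq> {}" using assms(2) by auto
  ultimately show ?thesis
    using assms(1,4) \<delta> growth S unfolding scale_def \<delta>_def
    by (intro sumset_density_of_scales[where t = t and z = z and y = y and \<theta> = \<theta>
          and \<delta> = "\<lambda>i. 1 / ln (l i)"]) auto
qed

end
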